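(* Let $A=(a_1,\ldots,a_r)$ be a resolution of $I$. \begin{itemize} \item If $A$ is conical (i.e.\ not spherical), then $R(I)$ collapses onto a point. \item If $A$ is spherical and, for each $i\in[r]$, $a_i$ dominates $b_i$ in $(I:a_1\cdots a_{i-1})$, then $R(I)$ collapses onto $\mathrm{join}\bigl(\Sigma, R(c(A))\bigr)$, where $\Sigma:=\mathrm{join}\bigl(\{1,a_1,b_1\},\ldots,\{1,a_r,b_r\}\bigr)$. In particular $R(I)$ is simple-homotopic to the $d(A)$-fold iterated suspension $\Sigma^{d(A)}\bigl(R(c(A))\bigr)$. \end{itemize}
   Context: Let $X=\{x_1,\ldots,x_n\}$ and let $I\subset\mathbb{Z}[X]$ be a monomial ideal containing $x_1^2,\ldots,x_n^2$. Identify square-free monomials with subsets of $X$; $R(I)$ denotes the simplicial complex whose faces are the (square-free) monomials not in $I$. For a monomial $x$, $(I:x)=\{m\mid xm\in I\}$ and $(I,x)$ is the ideal generated by $I$ and $x$. The complex $R(I)$ is a cone with apex $b$ if $b$ divides no minimal square-free generator of $I$. For variables $a,b\in X$, $a$ dominates $b$ in $I$ if $R(I)$ is not a cone with apex $b$ and $R(I,a)$ is a cone with apex $b$. For simplicial complexes $R(I_1),\ldots,R(I_k)$, $\mathrm{join}(R(I_1),\ldots,R(I_k))=\{\mathrm{lcm}\{m_i\}\mid m_i\in R(I_i)\}$; the suspension of $\Delta$ is $\mathrm{join}(\Delta,\{1,x,y\})$ with $x\neq y$ new variables. Given a sequence $A=(a_1,\ldots,a_r)$ of variables, set $I_i:=(I:a_1\cdots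 a_{i-1})$ for $i\in[r+1]$. $A$ is a resolution of $I$ if for every $i\in[r]$: $a_i\notin I_i$, and either $R(I_i)$ is a cone with apex $a_i$ or there is $b_i\in X$ such that $a_i$ dominates $b_i$ in $I_i$. The core of $A$ is $c(A):=I_{r+1}$ and its depth is $d(A):=r$. The resolution $A$ is spherical if $R(I_i)$ is not a cone with apex $a_i$ for all $i$, and conical otherwise. A complex collapses onto a subcomplex if it is obtained by a sequence of elementary collapses (removal of a maximal face $\sigma$ together with a codimension-one face $\tau\subset\sigma$ contained in no other face); simple-homotopy is the equivalence relation generated by elementary collapses. *)

theory Defs
  imports
    "HOL-Algebra.Ideal"
    "HOL-Library.Poly_Mapping"
    "HOL-Library.Infinite_Typeclass"
begin

type_synonym 'v zpoly = "('v \<Rightarrow>\<^sub>0 nat) \<Rightarrow>\<^sub>0 int"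

definition Var :: "'v \<Rightarrow> 'v zpoly" where
  "Var x = Poly_Mapping.single (Poly_Mapping.single x 1) 1"

text \<open>The ring of integer polynomials in the variables from \<^term>\<open>X\<close>, inside the polynomials over
  all variables of the type.\<close>

definition poly_ring :: "'v set \<Rightarrow> 'v zpoly ring" where
  "poly_ring X = \<lparr>carrier = {p. \<forall>m\<in>Poly_Mapping.keys p. Poly_Mapping.keys m \<subseteq> X},
     monoid.mult = (*), one = 1, zero = 0, add = (+)\<rparr>"

definition monomials :: "'v set \<Rightarrow> 'v zpoly set" where
  "monomials X = {Poly_Mapping.single m 1 | m. Poly_Mapping.keys m \<subseteq> X}"

definition monomial_ideal :: "'v set \<Rightarrow> 'v zpoly set \<Rightarrow> bool" where
  "monomial_ideal X I \<longleftrightarrow> (\<exists>M \<subseteq> monomials X. I = Idl\<^bsub>poly_ring X\<^esub> M)"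

definition colon :: "'v set \<Rightarrow> 'v zpoly set \<Rightarrow> 'v zpoly \<Rightarrow> 'v zpoly set" where
  "colon X I p = {q \<in> carrier (poly_ring X). p * q \<in> I}"

definition add_gen :: "'v set \<Rightarrow> 'v zpoly set \<Rightarrow> 'v zpoly \<Rightarrow> 'v zpoly set" where
  "add_gen X I p = Idl\<^bsub>poly_ring X\<^esub> (insert p I)"

definition sqfree_monom :: "'v set \<Rightarrow> 'v zpoly" where
  "sqfree_monom s = (\<Prod>x\<in>s. Var x)"

text \<open>Square-free monomials are identified with their sets of variables. In particular the
  monomial 1 is the empty face, and the least common multiple is the union.\<close>

definition face_complex :: "'v set \<Rightarrow> 'v zpoly set \<Rightarrow> 'v set set" where
  "face_complex X I = {s. s \<subseteq> X \<and> sqfree_monom s \<notin> I}"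

text \<open>The minimal generators of a monomial ideal are its monomials that are minimal with respect
  to divisibility.\<close>

definition min_gens :: "'v set \<Rightarrow> 'v zpoly set \<Rightarrow> 'v zpoly set" where
  "min_gens X I = {m \<in> monomials X \<inter> I. \<forall>m' \<in> monomials X \<inter> I. m' dvd m \<longrightarrow> m' = m}"

definition is_cone :: "'v set \<Rightarrow> 'v zpoly set \<Rightarrow> 'v \<Rightarrow> bool" where
  "is_cone X I b \<longleftrightarrow>
     (\<forall>s \<subseteq> X. sqfree_monom s \<in> min_gens X I \<longrightarrow> \<not> Var b dvd sqfree_monom s)"

definition dominates :: "'v set \<Rightarrow> 'v zpoly set \<Rightarrow> 'v \<Rightarrow> 'v \<Rightarrow> bool" where
  "dominates X I a b \<longleftrightarrow> a \<in> X \<and> b \<in> X \<and> \<not> is_cone X I b \<and> is_cone X (add_gen X I (Var a)) b"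

definition complex_join :: "'v set set list \<Rightarrow> 'v set set" where
  "complex_join Ks = {\<Union> (set ms) | ms. list_all2 (\<in>) ms Ks}"

text \<open>Sequences of variables are indexed from 0, so \<^term>\<open>colon_seq X I A i\<close> is the ideal
  $(I : a_1 \cdots a_i)$, written $I_{i+1}$ when counting from 1.\<close>

definition colon_seq :: "'v set \<Rightarrow> 'v zpoly set \<Rightarrow> 'v list \<Rightarrow> nat \<Rightarrow> 'v zpoly set" where
  "colon_seq X I A i = colon X I (prod_list (map Var (take i A)))"

definition resolution :: "'v set \<Rightarrow> 'v zpoly set \<Rightarrow> 'v list \<Rightarrow> bool" where
  "resolution X I A \<longleftrightarrow> set A \<subseteq> X \<and>
     (\<forall>i < length A. Var (A ! i) \<notin> colon_seq X I A i \<and>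
        (is_cone X (colon_seq X I A i) (A ! i) \<or>
         (\<exists>b\<in>X. dominates X (colon_seq X I A i) (A ! i) b)))"

definition core :: "'v set \<Rightarrow> 'v zpoly set \<Rightarrow> 'v list \<Rightarrow> 'v zpoly set" where
  "core X I A = colon_seq X I A (length A)"

definition depth :: "'v list \<Rightarrow> nat" where
  "depth A = length A"

definition spherical :: "'v set \<Rightarrow> 'v zpoly set \<Rightarrow> 'v list \<Rightarrow> bool" where
  "spherical X I A \<longleftrightarrow> (\<forall>i < length A. \<not> is_cone X (colon_seq X I A i) (A ! i))"

definition conical :: "'v set \<Rightarrow> 'v zpoly set \<Rightarrow> 'v list \<Rightarrow> bool" where
  "conical X I A \<longleftrightarrow> \<not> spherical X I A"

definition finite_complex :: "'v set set \<Rightarrow> bool" where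
  "finite_complex K \<longleftrightarrow> finite K \<and> (\<forall>s\<in>K. finite s) \<and> (\<forall>s\<in>K. \<forall>t \<subseteq> s. t \<in> K)"

text \<open>As usual the free face \<^term>\<open>\<tau>\<close> is nonempty: a point does not collapse onto the void
  complex.\<close>

definition elementary_collapse :: "'v set set \<Rightarrow> 'v set set \<Rightarrow> bool" where
  "elementary_collapse K L \<longleftrightarrow> finite_complex K \<and>
     (\<exists>\<sigma>\<in>K. \<exists>\<tau>\<in>K. \<tau> \<noteq> {} \<and> \<tau> \<subset> \<sigma> \<and> card \<sigma> = card \<tau> + 1 \<and>
        (\<forall>\<rho>\<in>K. \<sigma> \<subseteq> \<rho> \<longrightarrow> \<rho> = \<sigma>) \<and>
        (\<forall>\<rho>\<in>K. \<tau> \<subseteq> \<rho> \<longrightarrow> \<rho> = \<tau> \<or> \<rho> = \<sigma>) \<and>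
        L = K - {\<sigma>, \<tau>})"

definition collapses :: "'v set set \<Rightarrow> 'v set set \<Rightarrow> bool" where
  "collapses = elementary_collapse\<^sup>*\<^sup>*"

definition simple_homotopic :: "'v set set \<Rightarrow> 'v set set \<Rightarrow> bool" where
  "simple_homotopic = equivclp elementary_collapse"

text \<open>Suspension depends on the choice of two new vertices, hence a relation; its \<open>n\<close>-fold
  iteration is the relational power.\<close>

definition suspension :: "'v set set \<Rightarrow> 'v set set \<Rightarrow> bool" where
  "suspension K S \<longleftrightarrow>
     (\<exists>x y. x \<noteq> y \<and> x \<notin> \<Union>K \<and> y \<notin> \<Union>K \<and> S = complex_join [K, {{}, {x}, {y}}])"

lemma cring_poly_ring: "cring (poly_ring X)"
proof (rule cringI)
  show "abelian_group (poly_ring X)"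
  proof (rule abelian_groupI)
    fix p assume p: "p \<in> carrier (poly_ring X)"
    show "\<exists>q\<in>carrier (poly_ring X). q \<oplus>\<^bsub>poly_ring X\<^esub> p = \<zero>\<^bsub>poly_ring X\<^esub>"
      using p by (intro bexI[of _ "- p"]) (auto simp: poly_ring_def)
  next
    fix p q assume "p \<in> carrier (poly_ring X)" "q \<in> carrier (poly_ring X)"
    then show "p \<oplus>\<^bsub>poly_ring X\<^esub> q \<in> carrier (poly_ring X)"
      using keys_add[of p q] by (auto simp: poly_ring_def)
  qed (auto simp: poly_ring_def algebra_simps)
  show "Group.comm_monoid (poly_ring X)"
  proof (rule comm_monoidI)
    fix p q assume pq: "p \<in> carrier (poly_ring X)" "q \<in> carrier (poly_ring X)"
    have "Poly_Mapping.keys m \<subseteq> X" if m: "m \<in> Poly_Mapping.keys (p * q)" for m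
    proof -
      obtain a b where "m = a + b" "a \<in> Poly_Mapping.keys p" "b \<in> Poly_Mapping.keys q"
        using m keys_mult[of p q] by auto
      then show ?thesis using pq keys_add[of a b] by (fastforce simp: poly_ring_def)
    qed
    then show "p \<otimes>\<^bsub>poly_ring X\<^esub> q \<in> carrier (poly_ring X)" by (auto simp: poly_ring_def)
  qed (auto simp: poly_ring_def algebra_simps)
qed (auto simp: poly_ring_def algebra_simps)

lemma suspension_exists:
  fixes K :: "'v::infinite set set"
  assumes "finite_complex K"
  shows "\<exists>S. suspension K S"
proof -
  have fin: "finite (\<Union>K)" using assms by (auto simp: finite_complex_def)
  obtain x where x: "x \<notin> \<Union>K"
    using ex_new_if_finite[OF infinite_UNIV fin] by blast
  obtain y where "y \<notin> insert x (\<Union>K)"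
    using ex_new_if_finite[OF infinite_UNIV, of "insert x (\<Union>K)"] fin by blast
  then show ?thesis using x unfolding suspension_def by blast
qed

end

theory Submission
  imports Defs
begin

text \<open>The complex of \<open>(I : a)\<close> is the link \<open>L\<close> of \<open>a\<close>. If \<open>a\<close> dominates \<open>b\<close>, the faces avoiding
  \<open>a\<close> form a cone with apex \<open>b\<close>, and the faces outside the join of \<open>{1, a, b}\<close> with \<open>L\<close> can be removed
  in pairs that differ by \<open>b\<close>. Collapses of \<open>L\<close> extend to this join even if \<open>b\<close> is a vertex of
  \<open>L\<close>, so induction on the length of the resolution gives both collapses. Replacing \<open>b\<close> by a new
  vertex does not change the simple-homotopy type of the join, which yields the suspension.\<close>

section \<open>Collapses\<close>

text \<open>The obstacle is that \<open>b\<close> may be a vertex of the link, so that the join is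
  not a suspension. In the boundary of a triangle with vertices \<open>a\<close>, \<open>b\<close>,
  \<open>c\<close>, the vertex \<open>a\<close> dominates \<open>b\<close>, the link of
  \<open>a\<close> consists of the points \<open>b\<close> and \<open>c\<close>, and its join with
  \<open>{1, a, b}\<close> is the same triangle, whereas the suspension is a 4-cycle. The resolution
  may continue with \<open>b\<close>, so the pairs of vertices can overlap as well. Hence a face of
  the join can split in several ways. What survives is that \<open>a\<close> is not a vertex of the
  link, because its square lies in the ideal. Testing for \<open>a\<close> first and for
  \<open>b\<close> only afterwards gives a normal form for faces, along which matchings lift. For
  the suspension, \<open>b\<close> is exchanged for a new vertex at each step of the resolution, not
  after collapsing onto the full join.\<close>

lemma finite_complexD:
  assumes "finite_complex K"
  shows "finite K" "s \<in> K \<Longrightarrow> finite s" "s \<in> K \<Longrightarrow> t \<subseteq> s \<Longrightarrow> t \<in> K" "finite (\<Union>K)"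
  using assms by (auto simp: finite_complex_def)

text \<open>The removed pair contains every face of \<open>K\<close> above either of its members, so
  what remains is closed under subsets.\<close>

lemma elementary_collapse_complex:
  assumes "elementary_collapse K L"
  shows "finite_complex K" "finite_complex L" "L \<subseteq> K"
proof -
  show K: "finite_complex K" and "L \<subseteq> K"
    using assms by (auto simp: elementary_collapse_def)
  obtain \<sigma> \<tau> where *: "\<forall>\<rho>\<in>K. \<sigma> \<subseteq> \<rho> \<longrightarrow> \<rho> = \<sigma>" "\<forall>\<rho>\<in>K. \<tau> \<subseteq> \<rho> \<longrightarrow> \<rho> = \<tau> \<or> \<rho> = \<sigma>"
      "L = K - {\<sigma>, \<tau>}"
    using assms unfolding elementary_collapse_def by blast
  have "t \<in> L" if "s \<in> L" "t \<subseteq> s" for s t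
  proof -
    have s: "s \<in> K" "s \<noteq> \<sigma>" "s \<noteq> \<tau>" using that(1) *(3) by auto
    then have "t \<noteq> \<sigma>" "t \<noteq> \<tau>" using *(1,2) that(2) by auto
    then show ?thesis using finite_complexD(3)[OF K s(1) that(2)] *(3) by simp
  qed
  then show "finite_complex L"
    using finite_complexD(1,2)[OF K] \<open>L \<subseteq> K\<close> unfolding finite_complex_def by (meson finite_subset subsetD)
qed

lemma collapses_trans: "collapses K L \<Longrightarrow> collapses L M \<Longrightarrow> collapses K M"
  unfolding collapses_def by (rule rtranclp_trans)

lemma collapses_imp_simple_homotopic: "collapses K L \<Longrightarrow> simple_homotopic K L"
  unfolding collapses_def simple_homotopic_def by (rule rtranclp_into_equivclp)

lemma simple_homotopic_trans:
  "simple_homotopic K L \<Longrightarrow> simple_homotopic L M \<Longrightarrow> simple_homotopic K M"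
  unfolding simple_homotopic_def by (rule equivclp_trans)

lemma simple_homotopic_sym: "simple_homotopic K L \<Longrightarrow> simple_homotopic L K"
  unfolding simple_homotopic_def by (rule equivclp_sym)

lemma simple_homotopic_refl: "simple_homotopic K K"
  unfolding simple_homotopic_def by simp

text \<open>The faces outside \<open>L\<close> are matched by toggling the vertex \<open>b\<close>; a largest unmatched face
  without \<open>b\<close> is always free.\<close>

lemma vertex_collapse:
  assumes "finite_complex D" "L \<subseteq> D" "{} \<in> L"
    and "\<And>s t. s \<in> L \<Longrightarrow> t \<subseteq> s \<Longrightarrow> t \<in> L"
    and "\<And>s. s \<in> D \<Longrightarrow> s \<notin> L \<Longrightarrow> insert b s \<in> D"
    and "\<And>s. s \<in> L \<Longrightarrow> insert b s \<in> D \<Longrightarrow> insert b s \<in> L"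
  shows "collapses D L"
  using assms
proof (induction "card (D - L)" arbitrary: D rule: less_induct)
  case less
  note D = finite_complexD[OF less.prems(1)]
  show ?case
  proof (cases "D = L")
    case True
    then show ?thesis by (simp add: collapses_def)
  next
    case False
    define S where "S = {s \<in> D - L. b \<notin> s}"
    \<comment> \<open>Toggling \<open>b\<close> cannot cross into \<open>L\<close>: if
      \<open>s - {b}\<close> were in \<open>L\<close>, the last hypothesis would put
      \<open>s\<close> there too.\<close>
    have out: "s - {b} \<in> S" if "s \<in> D - L" for s
    proof -
      have "s - {b} \<in> D" using that D(3) by blast
      moreover have "s - {b} \<notin> L"
      proof
        assume "s - {b} \<in> L"
        moreover from this that have "b \<in> s" by (metis DiffD2 Diff_empty Diff_insert0)
        ultimately show False using less.prems(6)[of "s - {b}"] that by (auto simp: insert_absorb)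
      qed
      ultimately show ?thesis by (simp add: S_def)
    qed
    obtain s0 where "s0 \<in> D - L" using False less.prems(2) by blast
    then have "finite S" "S \<noteq> {}" using out D(1) by (auto simp: S_def)
    then obtain \<tau> where \<tau>: "\<tau> \<in> S" "\<And>s. s \<in> S \<Longrightarrow> \<tau> \<subseteq> s \<Longrightarrow> s = \<tau>"
      using finite_has_maximal[of S] by metis
    define \<sigma> where "\<sigma> = insert b \<tau>"
    have t: "\<tau> \<in> D" "\<tau> \<notin> L" "b \<notin> \<tau>" "finite \<tau>" using \<tau>(1) D(2) by (auto simp: S_def)
    have s: "\<sigma> \<in> D" "\<sigma> \<notin> L"
      using less.prems(5)[OF t(1,2)] less.prems(4)[of \<sigma> \<tau>] t by (auto simp: \<sigma>_def)
    \<comment> \<open>A face above \<open>\<tau>\<close> lies outside \<open>L\<close>, and deleting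
      \<open>b\<close> from it gives a member of \<open>S\<close> above \<open>\<tau>\<close>, which
      is \<open>\<tau>\<close> by maximality.\<close>
    have free: "\<rho> = \<tau> \<or> \<rho> = \<sigma>" if "\<rho> \<in> D" "\<tau> \<subseteq> \<rho>" for \<rho>
    proof -
      have "\<rho> \<in> D - L" using that t less.prems(4) by blast
      then have "\<rho> - {b} = \<tau>" using out \<tau>(2) that t(3) by blast
      then show ?thesis unfolding \<sigma>_def by blast
    qed
    have top: "\<rho> = \<sigma>" if "\<rho> \<in> D" "\<sigma> \<subseteq> \<rho>" for \<rho>
      using free[OF that(1)] that(2) t(3) by (auto simp: \<sigma>_def)
    \<comment> \<open>A free face has to be nonempty; \<open>{} \<in> L\<close> guarantees
      this.\<close>
    have "\<tau> \<noteq> {}" "\<tau> \<subset> \<sigma>" "card \<sigma> = card \<tau> + 1"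
      using t less.prems(3) by (auto simp: \<sigma>_def)
    then have el: "elementary_collapse D (D - {\<sigma>, \<tau>})"
      unfolding elementary_collapse_def using free top
      by (intro conjI[OF less.prems(1)] bexI[OF _ s(1)] bexI[OF _ t(1)]) simp
    have "collapses (D - {\<sigma>, \<tau>}) L"
    proof (rule less.hyps)
      show "card (D - {\<sigma>, \<tau>} - L) < card (D - L)"
        using t D(1) by (intro psubset_card_mono) auto
      show "finite_complex (D - {\<sigma>, \<tau>})" using elementary_collapse_complex(2)[OF el] .
      show "L \<subseteq> D - {\<sigma>, \<tau>}" using less.prems(2) t s by auto
      show "insert b r \<in> D - {\<sigma>, \<tau>}" if "r \<in> D - {\<sigma>, \<tau>}" "r \<notin> L" for r
      proof -
        \<comment> \<open>The remaining matching does not touch the removed pair: equality would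
          make \<open>r\<close> one of \<open>\<sigma>\<close> and \<open>\<tau>\<close>.\<close>
        have "insert b r \<noteq> \<sigma>"
          using that t(3) unfolding \<sigma>_def by (metis DiffD2 insertCI insert_absorb insert_ident)
        then show ?thesis using less.prems(5)[of r] that t(3) by auto
      qed
    qed (use less.prems in auto)
    then show ?thesis using el unfolding collapses_def by (meson converse_rtranclp_into_rtranclp)
  qed
qed

section \<open>Joins with a pair of points\<close>

definition two_point_join :: "'v \<Rightarrow> 'v \<Rightarrow> 'v set set \<Rightarrow> 'v set set" where
  "two_point_join a b K = K \<union> insert a ` K \<union> insert b ` K"

lemma two_point_join_mono: "K \<subseteq> L \<Longrightarrow> two_point_join a b K \<subseteq> two_point_join a b L"
  by (auto simp: two_point_join_def)

lemma two_point_joinI: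
  "s \<in> K \<Longrightarrow> u \<in> {s, insert a s, insert b s} \<Longrightarrow> u \<in> two_point_join a b K"
  by (auto simp: two_point_join_def)

lemma two_point_join_swap: "two_point_join a b K = two_point_join b a K"
  by (auto simp: two_point_join_def)

lemma finite_complex_two_point_join:
  assumes "finite_complex K"
  shows "finite_complex (two_point_join a b K)"
proof -
  note K = finite_complexD[OF assms]
  have "t \<in> K \<union> insert c ` K" if "s \<in> K" "t \<subseteq> insert c s" for s t c
  proof (cases "c \<in> t")
    case True
    then have "t = insert c (t - {c})" "t - {c} \<in> K" using that K(3)[of s "t - {c}"] by auto
    then show ?thesis by blast
  qed (use that K(3) in blast)
  then have "t \<in> two_point_join a b K" if "s \<in> two_point_join a b K" "t \<subseteq> s" for s t
    using that K(3) unfolding two_point_join_def by blast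
  then show ?thesis using K by (auto simp: finite_complex_def two_point_join_def)
qed

lemma mem_two_point_join_iff:
  assumes "finite_complex K" "a \<notin> \<Union>K" "a \<noteq> b"
  shows "s \<in> two_point_join a b K \<longleftrightarrow> s - {if a \<in> s then a else b} \<in> K"
proof
  assume "s \<in> two_point_join a b K"
  then consider "s \<in> K" | t where "t \<in> K" "s = insert a t" | t where "t \<in> K" "s = insert b t"
    unfolding two_point_join_def by blast
  then show "s - {if a \<in> s then a else b} \<in> K"
  proof cases
    case 1
    then show ?thesis using finite_complexD(3)[OF assms(1)] by blast
  next
    case 2
    then have "s - {if a \<in> s then a else b} = t" using assms(2) by auto
    then show ?thesis using 2 by simp
  next
    case 3
    then have "a \<notin> s" using assms(2,3) by auto
    then have "s - {if a \<in> s then a else b} \<subseteq> t" using 3 by auto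
    then show ?thesis using finite_complexD(3)[OF assms(1)] 3 by blast
  qed
next
  assume s: "s - {if a \<in> s then a else b} \<in> K"
  show "s \<in> two_point_join a b K"
  proof (cases "a \<in> s \<or> b \<in> s")
    case True
    then have "s = insert (if a \<in> s then a else b) (s - {if a \<in> s then a else b})" by auto
    then have "s \<in> insert (if a \<in> s then a else b) ` K" using s by (rule image_eqI)
    then show ?thesis unfolding two_point_join_def by (auto split: if_splits)
  next
    case False
    then show ?thesis using s by (simp add: two_point_join_def)
  qed
qed

text \<open>The faces lost in passing from \<open>K\<close> to \<open>L\<close> are those whose
  normal form leaves \<open>\<sigma>\<close> or \<open>\<tau>\<close>. They are matched by the
  vertex \<open>v\<close> in which these two differ. Since \<open>v\<close> is not \<open>a\<close>,
  toggling it does not change which of \<open>a\<close> and \<open>b\<close> is deleted.\<close>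

lemma two_point_join_elementary_collapse:
  assumes "elementary_collapse K L" "a \<notin> \<Union>K" "a \<noteq> b"
  shows "collapses (two_point_join a b K) (two_point_join a b L)"
proof -
  note c = elementary_collapse_complex[OF assms(1)]
  obtain \<sigma> \<tau> where e: "\<sigma> \<in> K" "\<tau> \<in> K" "\<tau> \<noteq> {}" "\<tau> \<subset> \<sigma>" "card \<sigma> = card \<tau> + 1" "L = K - {\<sigma>, \<tau>}"
    using assms(1) unfolding elementary_collapse_def by blast
  have "card (\<sigma> - \<tau>) = 1"
    using e finite_complexD(2)[OF c(1)] by (subst card_Diff_subset) auto
  then obtain v where v: "\<sigma> - \<tau> = {v}" by (meson card_1_singletonE)
  then have v: "v \<notin> \<tau>" "\<sigma> = insert v \<tau>" using e(4) by auto
  then have "a \<noteq> v" using assms(2) e(1) by auto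
  note D = finite_complexD(3)[OF c(1)]
  have aL: "a \<notin> \<Union>L" using c(3) assms(2) by blast
  note iK = mem_two_point_join_iff[OF c(1) assms(2,3)]
  note iL = mem_two_point_join_iff[OF c(2) aL assms(3)]
  show ?thesis
  proof (rule vertex_collapse[where b = v])
    show "finite_complex (two_point_join a b K)" using c(1) by (rule finite_complex_two_point_join)
    show "two_point_join a b L \<subseteq> two_point_join a b K" using c(3) by (rule two_point_join_mono)
    have "{} \<in> L" using e(3,4,6) D[OF e(1), of "{}"] by auto
    then show "{} \<in> two_point_join a b L" by (simp add: two_point_join_def)
    show "t \<in> two_point_join a b L" if "s \<in> two_point_join a b L" "t \<subseteq> s" for s t
      using finite_complexD(3)[OF finite_complex_two_point_join[OF c(2)] that] .
  next
    fix s assume s: "s \<in> two_point_join a b K" "s \<notin> two_point_join a b L"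
    define c where "c = (if a \<in> s then a else b)"
    have "s - {c} \<in> K" "s - {c} \<notin> L" using s unfolding iK iL c_def by auto
    then have "s - {c} = \<sigma> \<or> s - {c} = \<tau>" using e(6) by blast
    then have "insert v (s - {c}) = \<sigma>" unfolding v(2) by (elim disjE) (simp_all only: insert_absorb2)
    \<comment> \<open>If \<open>v\<close> is \<open>b\<close>, it may equal \<open>c\<close>, and
      then \<open>insert v s - {c}\<close> is only a subset of
      \<open>insert v (s - {c})\<close>.\<close>
    then have "insert v (s - {c}) \<in> K" using e(1) by simp
    then have "insert v s - {c} \<in> K" by (rule D) auto
    moreover have "(if a \<in> insert v s then a else b) = c" using \<open>a \<noteq> v\<close> by (auto simp: c_def)
    ultimately show "insert v s \<in> two_point_join a b K" unfolding iK by simp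
  next
    fix s assume s: "s \<in> two_point_join a b L" "insert v s \<in> two_point_join a b K"
    define c where "c = (if a \<in> s then a else b)"
    have c': "(if a \<in> insert v s then a else b) = c" using \<open>a \<noteq> v\<close> by (auto simp: c_def)
    have sL: "s - {c} \<in> L" using s(1) unfolding iL c_def .
    have sK: "insert v s - {c} \<in> K" using s(2) unfolding iK c' .
    have "insert v s - {c} \<in> L"
    \<comment> \<open>Equality means that \<open>v\<close> is \<open>b\<close> and \<open>a\<close>
      is not in \<open>s\<close>; adding \<open>v\<close> then leaves the remainder in
      \<open>K\<close> unchanged.\<close>
    proof (cases "v = c")
      case True
      then show ?thesis using sL by simp
    next
      case False
      then have eq: "insert v s - {c} = insert v (s - {c})" by auto
      have "insert v (s - {c}) \<noteq> \<sigma>"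
      proof
        assume "insert v (s - {c}) = \<sigma>"
        then have "s - {c} = \<sigma> \<or> s - {c} = \<tau>" using v by (metis insert_absorb insert_ident)
        then show False using sL e(6) by blast
      qed
      then show ?thesis using sK e(6) v(1) unfolding eq by auto
    qed
    then show "insert v s \<in> two_point_join a b L" unfolding iL c' .
  qed
qed

lemma two_point_join_collapses:
  assumes "collapses K L" "a \<notin> \<Union>K" "a \<noteq> b"
  shows "collapses (two_point_join a b K) (two_point_join a b L)"
proof -
  have "elementary_collapse\<^sup>*\<^sup>* K L" using assms(1) by (simp add: collapses_def)
  \<comment> \<open>The inclusion is carried along so that \<open>a\<close> stays outside every
    intermediate complex.\<close>
  then have "L \<subseteq> K \<and> collapses (two_point_join a b K) (two_point_join a b L)"
  proof induction
    case base
    then show ?case by (simp add: collapses_def)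
  next
    case (step L M)
    then have "a \<notin> \<Union>L" using assms(2) by blast
    with step show ?case
      using two_point_join_elementary_collapse[OF step.hyps(2) _ assms(3)] collapses_trans
        elementary_collapse_complex(3)[OF step.hyps(2)] by blast
  qed
  then show ?thesis by blast
qed

text \<open>Toggling the apex matches all faces except the empty one and \<open>{v}\<close>, which
  remain because the empty face is never free.\<close>

lemma cone_collapses:
  assumes "finite_complex K" "{} \<in> K" "\<And>s. s \<in> K \<Longrightarrow> insert v s \<in> K"
  shows "collapses K {{}, {v}}"
  by (rule vertex_collapse[where b = v]) (use assms in \<open>auto simp: subset_singleton_iff\<close>)

text \<open>The vertex \<open>b\<close> may lie in \<open>K\<close>. The common expansion is the union of the cone over \<open>K\<close> with
  apex \<open>a\<close> and the cone with apex \<open>c\<close> over \<open>b\<close> joined to \<open>K\<close>.\<close>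

lemma two_point_join_replace:
  assumes "finite_complex K" "a \<notin> \<Union>K" "a \<noteq> b" "c \<notin> \<Union>K" "c \<noteq> a" "c \<noteq> b"
  shows "simple_homotopic (two_point_join a b K) (two_point_join a c K)"
proof (cases "{} \<in> K")
  \<comment> \<open>This is the void complex, for which both joins are empty.\<close>
  case False
  then have "K = {}" using finite_complexD(3)[OF assms(1)] by blast
  then show ?thesis by (simp add: two_point_join_def simple_homotopic_refl)
next
  case True
  define D where "D = two_point_join a b K \<union> insert c ` (K \<union> insert b ` K)"
  \<comment> \<open>Joining twice with \<open>c\<close> and \<open>b\<close> adds every subset of
    \<open>{b, c}\<close> to the faces of \<open>K\<close>. In this form \<open>D\<close> inherits
    closure under subsets from joins.\<close>
  have D: "D = two_point_join a b K \<union> two_point_join c b (two_point_join c b K)"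
    unfolding D_def two_point_join_def by auto
  have "finite_complex D"
    using finite_complex_two_point_join[OF assms(1)] finite_complex_two_point_join[OF
        finite_complex_two_point_join[OF assms(1)]]
    unfolding D finite_complex_def by (meson Un_iff finite_Un)
  have Dc: "insert c (insert b u) \<in> D" if "u \<in> K" for u using that unfolding D_def by blast
  have "collapses D (two_point_join a b K)"
  proof (rule vertex_collapse[where b = b])
    fix s assume s: "s \<in> D" "s \<notin> two_point_join a b K"
    then obtain u where u: "u \<in> K" "s = insert c u \<or> s = insert c (insert b u)" unfolding D_def by blast
    then have "insert b s = insert c (insert b u)" by auto
    then show "insert b s \<in> D" using Dc[OF u(1)] by simp
  next
    fix s assume s: "s \<in> two_point_join a b K" "insert b s \<in> D"
    then consider "s \<in> K \<union> insert b ` K" | t where "t \<in> K" "s = insert a t"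
      unfolding two_point_join_def by blast
    then show "insert b s \<in> two_point_join a b K"
    proof cases
      \<comment> \<open>The face contains \<open>a\<close> and hence not \<open>c\<close>, so within
        \<open>D\<close> it must belong to the join with \<open>a\<close> and
        \<open>b\<close>.\<close>
      case 2
      then have "c \<notin> insert b s" using assms by auto
      then show ?thesis using s(2) unfolding D_def by auto
    qed (auto simp: two_point_join_def)
  qed (use \<open>finite_complex D\<close> True finite_complexD(3)[OF finite_complex_two_point_join[OF assms(1)]]
       in \<open>auto simp: D_def two_point_join_def\<close>)
  moreover have "collapses D (two_point_join a c K)"
  proof (rule vertex_collapse[where b = c])
    fix s assume s: "s \<in> D" "s \<notin> two_point_join a c K"
    then obtain u where u: "u \<in> K" "s = insert b u \<or> s = insert c (insert b u)"
      unfolding D_def two_point_join_def by blast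
    then have "insert c s = insert c (insert b u)" by auto
    then show "insert c s \<in> D" using Dc[OF u(1)] by simp
  next
    fix s assume s: "s \<in> two_point_join a c K" "insert c s \<in> D"
    then consider "s \<in> K \<union> insert c ` K" | t where "t \<in> K" "s = insert a t"
      unfolding two_point_join_def by blast
    then show "insert c s \<in> two_point_join a c K"
    proof cases
      case 2
      \<comment> \<open>No face of \<open>D\<close> contains both \<open>a\<close> and
        \<open>c\<close>, so each alternative is contradictory.\<close>
      obtain u where "u \<in> K" "insert c s \<in> {u, insert a u, insert b u, insert c u, insert c (insert b u)}"
        using s(2) unfolding D_def two_point_join_def by blast
      then show ?thesis using 2 assms by (auto 0 3)
    qed (auto simp: two_point_join_def)
  qed (use \<open>finite_complex D\<close> True finite_complexD(3)[OF finite_complex_two_point_join[OF assms(1)]]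
       in \<open>auto simp: D_def two_point_join_def\<close>)
  ultimately show ?thesis
    using collapses_imp_simple_homotopic simple_homotopic_sym simple_homotopic_trans by blast
qed

section \<open>Joins and suspensions\<close>

lemma complex_join_Nil: "complex_join [] = {{}}"
  by (auto simp: complex_join_def)

lemma complex_join_Cons: "complex_join (K # Ks) = {s \<union> t | s t. s \<in> K \<and> t \<in> complex_join Ks}"
proof (intro subset_antisym subsetI)
  fix u assume "u \<in> complex_join (K # Ks)"
  then obtain m ms where "m \<in> K" "list_all2 (\<in>) ms Ks" "u = m \<union> \<Union> (set ms)"
    by (auto simp: complex_join_def list_all2_Cons2)
  then show "u \<in> {s \<union> t | s t. s \<in> K \<and> t \<in> complex_join Ks}" unfolding complex_join_def by blast
next
  fix u assume "u \<in> {s \<union> t | s t. s \<in> K \<and> t \<in> complex_join Ks}"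
  then obtain m ms where "m \<in> K" "list_all2 (\<in>) ms Ks" "u = m \<union> \<Union> (set ms)"
    by (auto simp: complex_join_def)
  then have "list_all2 (\<in>) (m # ms) (K # Ks)" "u = \<Union> (set (m # ms))" by auto
  then show "u \<in> complex_join (K # Ks)" unfolding complex_join_def by blast
qed

lemma complex_join_pair: "complex_join [K, L] = {s \<union> t | s t. s \<in> K \<and> t \<in> L}"
  by (simp add: complex_join_Cons complex_join_Nil)

text \<open>Makes the first pair the outermost operation. This fits the induction on a resolution,
  in which the first variable is split off and the rest is handled inside its link.\<close>

lemma complex_join_two_point_Cons:
  "complex_join [complex_join ({{}, {a}, {b}} # Ks), L] = two_point_join a b (complex_join [complex_join Ks, L])"
proof -
  have 1: "complex_join ({{}, {a}, {b}} # Ks) = two_point_join a b (complex_join Ks)"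
    unfolding complex_join_Cons two_point_join_def by auto
  have 2: "{s \<union> t | s t. s \<in> two_point_join a b K \<and> t \<in> L} = two_point_join a b {s \<union> t | s t. s \<in> K \<and> t \<in> L}"
    (is "?l = ?r") for K
  proof (intro subset_antisym subsetI)
    fix u assume "u \<in> ?l"
    then obtain k t where k: "k \<in> K" "t \<in> L" and u: "u \<in> {k \<union> t, insert a (k \<union> t), insert b (k \<union> t)}"
      unfolding two_point_join_def by auto
    have "k \<union> t \<in> {s \<union> t | s t. s \<in> K \<and> t \<in> L}" using k by blast
    then show "u \<in> ?r" using u by (rule two_point_joinI)
  next
    fix u assume "u \<in> ?r"
    then obtain k t where k: "k \<in> K" "t \<in> L" and u: "u \<in> {k \<union> t, insert a (k \<union> t), insert b (k \<union> t)}"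
      unfolding two_point_join_def by auto
    then have "u \<in> {k \<union> t, insert a k \<union> t, insert b k \<union> t}" by simp
    then obtain s where "s \<in> {k, insert a k, insert b k}" "u = s \<union> t" by auto
    then show "u \<in> ?l" using two_point_joinI[OF k(1)] k(2) by blast
  qed
  show ?thesis unfolding 1 complex_join_pair 2 ..
qed

section \<open>Suspensions up to simple-homotopy\<close>

lemma suspension_iff:
  "suspension K S \<longleftrightarrow> (\<exists>x y. x \<noteq> y \<and> x \<notin> \<Union>K \<and> y \<notin> \<Union>K \<and> S = two_point_join x y K)"
proof -
  have "complex_join [K, {{}, {x}, {y}}] = two_point_join x y K" for x y :: 'a
    unfolding complex_join_pair two_point_join_def by auto
  then show ?thesis by (simp add: suspension_def)
qed

lemma suspensionI: "x \<noteq> y \<Longrightarrow> x \<notin> \<Union>K \<Longrightarrow> y \<notin> \<Union>K \<Longrightarrow> suspension K (two_point_join x y K)"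
  unfolding suspension_iff by blast

text \<open>The two pairs of vertices may overlap, so both are moved to a third pair
  \<open>u\<close>, \<open>v\<close> that avoids them.\<close>

lemma suspension_unique:
  fixes K :: "'v::infinite set set"
  assumes "finite_complex K" "suspension K S" "suspension K T"
  shows "simple_homotopic S T"
proof -
  obtain x y where xy: "x \<noteq> y" "x \<notin> \<Union>K" "y \<notin> \<Union>K" "S = two_point_join x y K"
    using assms(2) unfolding suspension_iff by blast
  obtain z w where zw: "z \<noteq> w" "z \<notin> \<Union>K" "w \<notin> \<Union>K" "T = two_point_join z w K"
    using assms(3) unfolding suspension_iff by blast
  have fin: "finite (\<Union>K \<union> {x, y, z, w})" using finite_complexD(4)[OF assms(1)] by simp
  obtain u where u: "u \<notin> \<Union>K \<union> {x, y, z, w}" using ex_new_if_finite[OF infinite_UNIV fin] by blast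
  have "finite (insert u (\<Union>K \<union> {x, y, z, w}))" using fin by blast
  then obtain v where v: "v \<notin> insert u (\<Union>K \<union> {x, y, z, w})"
    using ex_new_if_finite[OF infinite_UNIV] by blast
  have to: "simple_homotopic (two_point_join p q K) (two_point_join u v K)"
    if "p \<noteq> q" "p \<notin> \<Union>K" "q \<notin> \<Union>K" "p \<in> {x, y, z, w}" "q \<in> {x, y, z, w}" for p q
  proof -
    have "simple_homotopic (two_point_join p q K) (two_point_join p v K)"
      by (rule two_point_join_replace) (use that u v assms(1) in auto)
    \<comment> \<open>\<open>two_point_join_replace\<close> exchanges the vertex in second position,
      so the pair is swapped to replace its other member.\<close>
    moreover have "simple_homotopic (two_point_join v p K) (two_point_join v u K)"
      by (rule two_point_join_replace) (use that u v assms(1) in auto)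
    ultimately show ?thesis by (metis simple_homotopic_trans two_point_join_swap)
  qed
  show ?thesis using to[of x y] to[of z w] xy zw simple_homotopic_sym simple_homotopic_trans by blast
qed

text \<open>The vertices used for \<open>T\<close> are new to \<open>L\<close> but may occur in
  \<open>K\<close>. Both suspensions are therefore compared with those on one pair that is new to
  \<open>K\<close>, hence also to \<open>L\<close>.\<close>

lemma suspension_elementary_collapse:
  fixes K :: "'v::infinite set set"
  assumes "elementary_collapse K L" "suspension K S" "suspension L T"
  shows "simple_homotopic S T"
proof -
  note c = elementary_collapse_complex[OF assms(1)]
  obtain S' where "suspension K S'" using suspension_exists[OF c(1)] by blast
  then obtain x y where xy: "x \<noteq> y" "x \<notin> \<Union>K" "y \<notin> \<Union>K" unfolding suspension_iff by blast
  have "simple_homotopic S (two_point_join x y K)"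
    using suspension_unique[OF c(1) assms(2) suspensionI[OF xy]] .
  moreover have "simple_homotopic (two_point_join x y K) (two_point_join x y L)"
    using two_point_join_elementary_collapse[OF assms(1) xy(2,1)] by (rule collapses_imp_simple_homotopic)
  moreover have "suspension L (two_point_join x y L)"
    using xy c(3) unfolding suspension_iff by blast
  then have "simple_homotopic (two_point_join x y L) T"
    using suspension_unique[OF c(2) _ assms(3)] by blast
  ultimately show ?thesis using simple_homotopic_trans by blast
qed

lemma suspension_simple_homotopic:
  fixes K :: "'v::infinite set set"
  assumes "simple_homotopic K L" "finite_complex K" "suspension K S" "suspension L T"
  shows "simple_homotopic S T"
proof -
  have "equivclp elementary_collapse K L" using assms(1) by (simp add: simple_homotopic_def)
  \<comment> \<open>The claim covers all suspensions of the intermediate complex, since none is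
    canonical. Finiteness ensures that one exists, which the chain of equivalences passes
    through.\<close>
  then have "finite_complex L \<and> (\<forall>T. suspension L T \<longrightarrow> simple_homotopic S T)"
  proof (induction rule: equivclp_induct)
    case base
    then show ?case using assms(2,3) suspension_unique by blast
  next
    case (step L M)
    then obtain U where U: "suspension L U" "simple_homotopic S U" using suspension_exists by blast
    have "simple_homotopic U T" if "suspension M T" for T
      using step.hyps(2) suspension_elementary_collapse U(1) that simple_homotopic_sym by blast
    then have "\<forall>T. suspension M T \<longrightarrow> simple_homotopic S T" using U(2) simple_homotopic_trans by blast
    moreover have "finite_complex M" using step.hyps(2) elementary_collapse_complex(1,2) by blast
    ultimately show ?case by blast
  qed
  then show ?thesis using assms(4) by blast
qed

section \<open>Ideals containing the squares of the variables\<close>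

lemma carrier_poly_ring:
  "p \<in> carrier (poly_ring X) \<longleftrightarrow> (\<forall>m\<in>Poly_Mapping.keys p. Poly_Mapping.keys m \<subseteq> X)"
  by (simp add: poly_ring_def)

lemma mult_carrier_poly_ring:
  "p \<in> carrier (poly_ring X) \<Longrightarrow> q \<in> carrier (poly_ring X) \<Longrightarrow> p * q \<in> carrier (poly_ring X)"
  using monoid.m_closed[OF comm_monoid.axioms(1)[OF cring.axioms(2)[OF cring_poly_ring]], of p X q]
  by (simp add: poly_ring_def)

section \<open>Exponent vectors and square-free monomials\<close>

definition sqfree_exp :: "'v set \<Rightarrow> 'v \<Rightarrow>\<^sub>0 nat" where
  "sqfree_exp s = (\<Sum>x\<in>s. Poly_Mapping.single x 1)"

lemma lookup_sqfree_exp: "finite s \<Longrightarrow> Poly_Mapping.lookup (sqfree_exp s) x = (if x \<in> s then 1 else 0)"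
  by (simp add: sqfree_exp_def lookup_sum lookup_single when_def)

lemma keys_sqfree_exp: "finite s \<Longrightarrow> Poly_Mapping.keys (sqfree_exp s) = s"
  by (auto simp: in_keys_iff lookup_sqfree_exp split: if_splits)

lemma sqfree_monom_eq_single: "sqfree_monom s = Poly_Mapping.single (sqfree_exp s) 1"
  unfolding sqfree_monom_def sqfree_exp_def
  by (induction s rule: infinite_finite_induct) (auto simp: Var_def mult_single single_one)

lemma sqfree_monom_in_monomials: "finite s \<Longrightarrow> s \<subseteq> X \<Longrightarrow> sqfree_monom s \<in> monomials X"
  unfolding monomials_def sqfree_monom_eq_single using keys_sqfree_exp by blast

lemma sqfree_monom_carrier: "finite s \<Longrightarrow> s \<subseteq> X \<Longrightarrow> sqfree_monom s \<in> carrier (poly_ring X)"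
  by (simp add: carrier_poly_ring sqfree_monom_eq_single keys_sqfree_exp)

lemma Var_carrier: "x \<in> X \<Longrightarrow> Var x \<in> carrier (poly_ring X)"
  by (simp add: carrier_poly_ring Var_def)

lemma sqfree_monom_inj:
  assumes "finite s" "finite t" "sqfree_monom s = sqfree_monom t"
  shows "s = t"
proof -
  have "sqfree_exp s = sqfree_exp t"
    using assms(3) unfolding sqfree_monom_eq_single by (metis keys_single singleton_inject one_neq_zero)
  then show ?thesis using keys_sqfree_exp assms(1,2) by metis
qed

lemma sqfree_monom_insert: "finite s \<Longrightarrow> x \<notin> s \<Longrightarrow> sqfree_monom (insert x s) = Var x * sqfree_monom s"
  by (simp add: sqfree_monom_def)

lemma sqfree_monom_remove: "finite s \<Longrightarrow> x \<in> s \<Longrightarrow> sqfree_monom s = Var x * sqfree_monom (s - {x})"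
  by (simp add: sqfree_monom_def prod.remove)

lemma sqfree_monom_subset:
  "finite s \<Longrightarrow> t \<subseteq> s \<Longrightarrow> sqfree_monom s = sqfree_monom t * sqfree_monom (s - t)"
  unfolding sqfree_monom_def by (metis mult.commute prod.subset_diff)

lemma single_dvd_sqfree_monom:
  assumes "Poly_Mapping.single m 1 dvd sqfree_monom s" "finite s"
  shows "Poly_Mapping.keys m \<subseteq> s" "m = sqfree_exp (Poly_Mapping.keys m)"
proof -
  obtain q where q: "sqfree_monom s = Poly_Mapping.single m 1 * q" using assms(1) by (elim dvdE)
  \<comment> \<open>The cofactor \<open>q\<close> is an arbitrary polynomial, but one of its
    exponents \<open>k\<close> must satisfy \<open>sqfree_exp s = m + k\<close>, which bounds
    \<open>m\<close> pointwise.\<close>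
  have "sqfree_exp s \<in> Poly_Mapping.keys (Poly_Mapping.single m 1 * q)"
    unfolding q[symmetric] sqfree_monom_eq_single by simp
  then obtain k where "sqfree_exp s = m + k" using keys_mult by fastforce
  then have le: "Poly_Mapping.lookup m x \<le> (if x \<in> s then 1 else 0)" for x
    using lookup_sqfree_exp[OF assms(2), of x] by (simp add: lookup_add split: if_splits)
  show "Poly_Mapping.keys m \<subseteq> s"
  proof
    fix x assume "x \<in> Poly_Mapping.keys m"
    then show "x \<in> s" using le[of x] by (auto simp: in_keys_iff split: if_splits)
  qed
  show "m = sqfree_exp (Poly_Mapping.keys m)"
  proof (rule poly_mapping_eqI)
    fix x show "Poly_Mapping.lookup m x = Poly_Mapping.lookup (sqfree_exp (Poly_Mapping.keys m)) x"
      using le[of x] by (auto simp: lookup_sqfree_exp in_keys_iff split: if_splits)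
  qed
qed

lemma Var_dvd_sqfree_monom_iff:
  assumes "finite s"
  shows "Var x dvd sqfree_monom s \<longleftrightarrow> x \<in> s"
  using single_dvd_sqfree_monom(1)[OF _ assms, of "Poly_Mapping.single x 1"]
    sqfree_monom_remove[OF assms, of x] by (auto simp: Var_def)

text \<open>Serves as an upper bound for generated ideals: once the generators have all exponents in
  \<open>U\<close>, so does every element of the ideal.\<close>

lemma ideal_keys_in:
  assumes "\<And>m. m \<in> U \<Longrightarrow> Poly_Mapping.keys m \<subseteq> X"
    and "\<And>m k. m \<in> U \<Longrightarrow> Poly_Mapping.keys k \<subseteq> X \<Longrightarrow> m + k \<in> U"
  shows "ideal {p :: 'v zpoly. Poly_Mapping.keys p \<subseteq> U} (poly_ring X)" (is "ideal ?J _")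
proof (rule idealI)
  interpret cring "poly_ring X" by (rule cring_poly_ring)
  show "ring (poly_ring X)" ..
  show "subgroup ?J (add_monoid (poly_ring X))"
  proof
    show "?J \<subseteq> carrier (add_monoid (poly_ring X))" using assms(1) by (force simp: carrier_poly_ring)
    show "p \<otimes>\<^bsub>add_monoid (poly_ring X)\<^esub> q \<in> ?J" if "p \<in> ?J" "q \<in> ?J" for p q
      using that keys_add[of p q] by (auto simp: poly_ring_def)
    show "\<one>\<^bsub>add_monoid (poly_ring X)\<^esub> \<in> ?J" by (simp add: poly_ring_def)
    show "inv\<^bsub>add_monoid (poly_ring X)\<^esub> p \<in> ?J" if "p \<in> ?J" for p
    proof -
      have c: "p \<in> carrier (poly_ring X)" "- p \<in> carrier (poly_ring X)"
        using that assms(1) by (force simp: carrier_poly_ring)+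
      have "- p \<oplus>\<^bsub>poly_ring X\<^esub> p = \<zero>\<^bsub>poly_ring X\<^esub>" by (simp add: poly_ring_def)
      then have "\<ominus>\<^bsub>poly_ring X\<^esub> p = - p" using c minus_equality by blast
      then show ?thesis using that by (simp add: a_inv_def)
    qed
  qed
  show "q \<otimes>\<^bsub>poly_ring X\<^esub> p \<in> ?J" if "p \<in> ?J" "q \<in> carrier (poly_ring X)" for p q
    using that keys_mult[of q p] assms(2) by (fastforce simp: poly_ring_def add.commute)
  show "p \<otimes>\<^bsub>poly_ring X\<^esub> q \<in> ?J" if "p \<in> ?J" "q \<in> carrier (poly_ring X)" for p q
    using that keys_mult[of p q] assms(2) by (fastforce simp: poly_ring_def)
qed

lemma ideal_mult:
  "ideal I (poly_ring X) \<Longrightarrow> p \<in> I \<Longrightarrow> q \<in> carrier (poly_ring X) \<Longrightarrow> p * q \<in> I"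
  using ideal.I_r_closed[of I "poly_ring X" p q] by (simp add: poly_ring_def)

text \<open>Unlike being generated by monomials, these closure properties are immediately inherited by
  colon ideals.\<close>

definition quadratic_monomial_ideal :: "'v set \<Rightarrow> 'v zpoly set \<Rightarrow> bool" where
  "quadratic_monomial_ideal X I \<longleftrightarrow> I \<subseteq> carrier (poly_ring X) \<and>
     (\<forall>p\<in>I. \<forall>q\<in>carrier (poly_ring X). p * q \<in> I) \<and>
     (\<forall>p\<in>I. \<forall>m\<in>Poly_Mapping.keys p. Poly_Mapping.single m 1 \<in> I) \<and>
     (\<forall>x\<in>X. Var x ^ 2 \<in> I)"

lemma monomial_ideal_imp_quadratic:
  assumes "monomial_ideal X I" "\<forall>x\<in>X. Var x ^ 2 \<in> I"
  shows "quadratic_monomial_ideal X I"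
proof -
  interpret cring "poly_ring X" by (rule cring_poly_ring)
  obtain M where M: "M \<subseteq> monomials X" "I = Idl\<^bsub>poly_ring X\<^esub> M"
    using assms(1) by (auto simp: monomial_ideal_def)
  have Mc: "M \<subseteq> carrier (poly_ring X)" using M(1) by (auto simp: monomials_def carrier_poly_ring)
  have I: "ideal I (poly_ring X)" unfolding M(2) using Mc by (rule genideal_ideal)
  \<comment> \<open>With this \<open>U\<close>, membership of all exponents says that every monomial
    occurring in the polynomial lies in \<open>I\<close>.\<close>
  define U where "U = {m. Poly_Mapping.keys m \<subseteq> X \<and> Poly_Mapping.single m 1 \<in> I}"
  have "ideal {p. Poly_Mapping.keys p \<subseteq> U} (poly_ring X)"
  proof (rule ideal_keys_in)
    fix m k :: "'a \<Rightarrow>\<^sub>0 nat" assume m: "m \<in> U" "Poly_Mapping.keys k \<subseteq> X"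
    have "Poly_Mapping.single m 1 * Poly_Mapping.single k 1 \<in> I"
      by (rule ideal_mult[OF I]) (use m in \<open>auto simp: U_def carrier_poly_ring\<close>)
    then show "m + k \<in> U" using m keys_add[of m k] by (auto simp: U_def mult_single)
  qed (auto simp: U_def)
  moreover have "M \<subseteq> {p. Poly_Mapping.keys p \<subseteq> U}"
    using M(1) genideal_self[OF Mc] unfolding M(2)[symmetric] by (force simp: U_def monomials_def)
  ultimately have "I \<subseteq> {p. Poly_Mapping.keys p \<subseteq> U}" unfolding M(2) by (rule genideal_minimal)
  then have "\<forall>p\<in>I. \<forall>m\<in>Poly_Mapping.keys p. Poly_Mapping.single m 1 \<in> I" by (auto simp: U_def)
  moreover have "I \<subseteq> carrier (poly_ring X)"
    using ideal.axioms(1)[OF I] additive_subgroup.a_subset by blast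
  ultimately show ?thesis
    using ideal_mult[OF I] assms(2) by (auto simp: quadratic_monomial_ideal_def)
qed

text \<open>Multiplying by a variable shifts exponents injectively, so no terms cancel. The
  monomials of an element of \<open>(I : a)\<close> can thus be read off from its multiple in
  \<open>I\<close>.\<close>

lemma keys_Var_mult: "Poly_Mapping.single x 1 + m \<in> Poly_Mapping.keys (Var x * p) \<longleftrightarrow> m \<in> Poly_Mapping.keys p"
proof -
  have "Poly_Mapping.lookup (Var x * p) (Poly_Mapping.single x 1 + m) = Poly_Mapping.lookup p m"
    unfolding Var_def lookup_mult lookup_single by (simp add: when_mult)
  then show ?thesis by (simp add: in_keys_iff)
qed

lemma quadratic_monomial_ideal_colon:
  assumes "quadratic_monomial_ideal X I" "a \<in> X"
  shows "quadratic_monomial_ideal X (colon X I (Var a))"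
proof -
  have I: "I \<subseteq> carrier (poly_ring X)" "\<And>p q. p \<in> I \<Longrightarrow> q \<in> carrier (poly_ring X) \<Longrightarrow> p * q \<in> I"
    "\<And>p m. p \<in> I \<Longrightarrow> m \<in> Poly_Mapping.keys p \<Longrightarrow> Poly_Mapping.single m 1 \<in> I"
    "\<And>x. x \<in> X \<Longrightarrow> Var x ^ 2 \<in> I"
    using assms(1) by (auto simp: quadratic_monomial_ideal_def)
  show ?thesis
    unfolding quadratic_monomial_ideal_def
  proof (intro conjI ballI)
    show "colon X I (Var a) \<subseteq> carrier (poly_ring X)" by (auto simp: colon_def)
    show "p * q \<in> colon X I (Var a)" if "p \<in> colon X I (Var a)" "q \<in> carrier (poly_ring X)" for p q
      using that I(2)[of "Var a * p" q] mult_carrier_poly_ring by (auto simp: colon_def mult.assoc)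
    show "Poly_Mapping.single m 1 \<in> colon X I (Var a)"
      if "p \<in> colon X I (Var a)" "m \<in> Poly_Mapping.keys p" for p m
    proof -
      have "Poly_Mapping.single (Poly_Mapping.single a 1 + m) 1 \<in> I"
        using that I(3)[of "Var a * p"] keys_Var_mult[of a m p] unfolding colon_def by blast
      then show ?thesis using that by (auto simp: colon_def carrier_poly_ring Var_def mult_single)
    qed
    show "Var x ^ 2 \<in> colon X I (Var a)" if "x \<in> X" for x
      using I(2)[OF I(4)[OF that] Var_carrier[OF assms(2)]] I(1,4) that
      by (auto simp: colon_def mult.commute)
  qed
qed

section \<open>Cones, vertex deletions and links in face complexes\<close>

lemma finite_complex_face_complex:
  assumes "finite X" "quadratic_monomial_ideal X I"
  shows "finite_complex (face_complex X I)"
proof -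
  have "t \<in> face_complex X I" if "s \<in> face_complex X I" "t \<subseteq> s" for s t
  proof -
    have "s \<subseteq> X" using that(1) by (auto simp: face_complex_def)
    then have "finite s" "sqfree_monom (s - t) \<in> carrier (poly_ring X)"
      using assms(1) finite_subset sqfree_monom_carrier by (blast, metis Diff_subset finite_subset subset_trans)
    then show ?thesis
      using that sqfree_monom_subset[of s t] assms(2)
      by (auto simp: face_complex_def quadratic_monomial_ideal_def)
  qed
  moreover have "face_complex X I \<subseteq> Pow X" by (auto simp: face_complex_def)
  ultimately show ?thesis
    using assms(1) unfolding finite_complex_def by (meson Pow_iff finite_Pow_iff finite_subset subsetD)
qed

text \<open>Translates apexes from generators to faces: square-free minimal generators are the
  minimal nonfaces. The closure hypothesis is shared by \<open>I\<close> and the ideal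
  \<open>(I, a)\<close>, to both of which the lemma is applied.\<close>

lemma is_cone_iff:
  assumes "finite X" "b \<in> X" "\<And>p q. p \<in> J \<Longrightarrow> q \<in> carrier (poly_ring X) \<Longrightarrow> p * q \<in> J"
  shows "is_cone X J b \<longleftrightarrow> (\<forall>s\<in>face_complex X J. insert b s \<in> face_complex X J)"
proof (intro iffI ballI)
  fix s assume cone: "is_cone X J b" and s: "s \<in> face_complex X J"
  then have sX: "s \<subseteq> X" "sqfree_monom s \<notin> J" by (auto simp: face_complex_def)
  show "insert b s \<in> face_complex X J"
  proof (rule ccontr)
    assume "insert b s \<notin> face_complex X J"
    then have "sqfree_monom (insert b s) \<in> J" using sX assms(2) by (auto simp: face_complex_def)
    \<comment> \<open>A minimal nonface inside \<open>insert b s\<close> has to contain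
      \<open>b\<close>, because \<open>s\<close> is a face.\<close>
    define S where "S = {t. t \<subseteq> insert b s \<and> sqfree_monom t \<in> J}"
    have "finite (insert b s)" using sX assms(1) finite_subset by blast
    then have "finite S" "S \<noteq> {}" using \<open>sqfree_monom (insert b s) \<in> J\<close> by (auto simp: S_def)
    then obtain t where t: "t \<in> S" "\<And>u. u \<in> S \<Longrightarrow> u \<subseteq> t \<Longrightarrow> u = t"
      using finite_has_minimal[of S] by metis
    have ft: "t \<subseteq> X" "sqfree_monom t \<in> J" using t(1) sX(1) assms(2) unfolding S_def by blast+
    then have ft: "finite t" "t \<subseteq> X" "sqfree_monom t \<in> J" using assms(1) by (auto intro: finite_subset)
    have "b \<in> t"
    proof (rule ccontr)
      assume "b \<notin> t"
      then have "t \<subseteq> s" using t(1) by (auto simp: S_def)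
      moreover have "finite s" "sqfree_monom (s - t) \<in> carrier (poly_ring X)"
        using sX \<open>finite (insert b s)\<close> by (auto intro!: sqfree_monom_carrier)
      ultimately show False
        using assms(3)[OF ft(3), of "sqfree_monom (s - t)"] sqfree_monom_subset[of s t] sX(2) by simp
    qed
    \<comment> \<open>Monomial divisors of a square-free monomial are square-free, so minimality
      among sets gives minimality among all monomials of \<open>J\<close>.\<close>
    have "m' = sqfree_monom t" if m': "m' \<in> monomials X \<inter> J" "m' dvd sqfree_monom t" for m'
    proof -
      obtain m where m: "m' = Poly_Mapping.single m 1" using m'(1) unfolding monomials_def by blast
      note d = single_dvd_sqfree_monom[OF m'(2)[unfolded m] ft(1)]
      have "m' = sqfree_monom (Poly_Mapping.keys m)" using d(2) m by (simp add: sqfree_monom_eq_single)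
      moreover from this have "Poly_Mapping.keys m \<in> S" using d(1) t(1) m'(1) by (auto simp: S_def)
      ultimately show ?thesis using t(2) d(1) by metis
    qed
    then have "sqfree_monom t \<in> min_gens X J"
      using sqfree_monom_in_monomials[OF ft(1,2)] ft(3) by (auto simp: min_gens_def)
    then show False
      using cone ft(2) \<open>b \<in> t\<close> Var_dvd_sqfree_monom_iff[OF ft(1)] by (auto simp: is_cone_def)
  qed
next
  assume R: "\<forall>s\<in>face_complex X J. insert b s \<in> face_complex X J"
  show "is_cone X J b"
    unfolding is_cone_def
  proof (intro allI impI notI)
    fix s assume s: "s \<subseteq> X" "sqfree_monom s \<in> min_gens X J" "Var b dvd sqfree_monom s"
    have fs: "finite s" using s(1) assms(1) finite_subset by blast
    have b: "b \<in> s" using s(3) by (simp add: Var_dvd_sqfree_monom_iff[OF fs])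
    have J: "sqfree_monom s \<in> J" using s(2) by (auto simp: min_gens_def)
    show False
    proof (cases "sqfree_monom (s - {b}) \<in> J")
      case True
      moreover have "sqfree_monom (s - {b}) \<in> monomials X" "sqfree_monom (s - {b}) dvd sqfree_monom s"
        using fs s(1) sqfree_monom_remove[OF fs b] by (auto intro: sqfree_monom_in_monomials)
      ultimately have "sqfree_monom (s - {b}) = sqfree_monom s"
        using s(2) unfolding min_gens_def by simp
      then show False using sqfree_monom_inj[of "s - {b}" s] fs b by auto
    next
      case False
      then have "s - {b} \<in> face_complex X J" using s(1) by (auto simp: face_complex_def)
      then have "insert b (s - {b}) \<in> face_complex X J" using R by blast
      then show False using J b by (simp add: face_complex_def insert_absorb)
    qed
  qed
qed

text \<open>Adjoining the variable \<open>a\<close> deletes the vertex \<open>a\<close>.\<close>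

lemma add_gen_Var:
  assumes "quadratic_monomial_ideal X I" "finite X" "a \<in> X"
  shows "ideal (add_gen X I (Var a)) (poly_ring X)"
    and "face_complex X (add_gen X I (Var a)) = {s \<in> face_complex X I. a \<notin> s}"
proof -
  interpret cring "poly_ring X" by (rule cring_poly_ring)
  have I: "I \<subseteq> carrier (poly_ring X)" "\<And>p q. p \<in> I \<Longrightarrow> q \<in> carrier (poly_ring X) \<Longrightarrow> p * q \<in> I"
    "\<And>p m. p \<in> I \<Longrightarrow> m \<in> Poly_Mapping.keys p \<Longrightarrow> Poly_Mapping.single m 1 \<in> I"
    using assms(1) by (auto simp: quadratic_monomial_ideal_def)
  have c: "insert (Var a) I \<subseteq> carrier (poly_ring X)" using I(1) Var_carrier[OF assms(3)] by blast
  show id: "ideal (add_gen X I (Var a)) (poly_ring X)"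
    unfolding add_gen_def using c by (rule genideal_ideal)
  have sub: "insert (Var a) I \<subseteq> add_gen X I (Var a)"
    unfolding add_gen_def using c by (rule genideal_self)
  \<comment> \<open>The exponents that \<open>(I, a)\<close> should have: those of monomials in
    \<open>I\<close> and those divisible by \<open>a\<close>.\<close>
  define U where
    "U = {m. Poly_Mapping.keys m \<subseteq> X \<and> (Poly_Mapping.single m 1 \<in> I \<or> a \<in> Poly_Mapping.keys m)}"
  have "ideal {p. Poly_Mapping.keys p \<subseteq> U} (poly_ring X)"
  proof (rule ideal_keys_in)
    fix m k :: "'a \<Rightarrow>\<^sub>0 nat" assume m: "m \<in> U" "Poly_Mapping.keys k \<subseteq> X"
    have k: "Poly_Mapping.single k (1::int) \<in> carrier (poly_ring X)" using m by (auto simp: carrier_poly_ring)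
    have "Poly_Mapping.single (m + k) 1 \<in> I" if "Poly_Mapping.single m 1 \<in> I"
      using I(2)[OF that k] by (simp add: mult_single)
    moreover have "a \<in> Poly_Mapping.keys (m + k)" if "a \<in> Poly_Mapping.keys m"
      using that by (simp add: in_keys_iff lookup_add)
    ultimately show "m + k \<in> U" using m keys_add[of m k] by (auto simp: U_def)
  qed (auto simp: U_def)
  moreover have "insert (Var a) I \<subseteq> {p. Poly_Mapping.keys p \<subseteq> U}"
    using I(1,3) assms(3) by (auto simp: U_def Var_def carrier_poly_ring subset_iff)
  ultimately have "add_gen X I (Var a) \<subseteq> {p. Poly_Mapping.keys p \<subseteq> U}"
    unfolding add_gen_def by (rule genideal_minimal)
  then have 1: "sqfree_monom s \<in> I \<or> a \<in> s" if "sqfree_monom s \<in> add_gen X I (Var a)" "s \<subseteq> X" for s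
    using that finite_subset[OF that(2) assms(2)] by (auto simp: U_def sqfree_monom_eq_single keys_sqfree_exp)
  have 2: "sqfree_monom s \<in> add_gen X I (Var a)" if "a \<in> s" "s \<subseteq> X" for s
  proof -
    have "finite s" using that(2) assms(2) finite_subset by blast
    then show ?thesis
      using sqfree_monom_remove[OF _ that(1)] sub that(2)
        ideal_mult[OF id, of "Var a" "sqfree_monom (s - {a})"] sqfree_monom_carrier[of "s - {a}" X] by auto
  qed
  show "face_complex X (add_gen X I (Var a)) = {s \<in> face_complex X I. a \<notin> s}"
    using 1 2 sub by (auto simp: face_complex_def)
qed

text \<open>The cone property keeps \<open>insert b s\<close> among the faces that avoid
  \<open>a\<close>, which yields both claims. For \<open>a \<noteq> b\<close> some face avoiding
  \<open>a\<close> must exist; in the applications it is the empty one.\<close>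

lemma dominatesD:
  assumes "quadratic_monomial_ideal X I" "finite X" "dominates X I a b" "s \<in> face_complex X I" "a \<notin> s"
  shows "insert b s \<in> face_complex X I" "a \<noteq> b"
proof -
  have ab: "a \<in> X" "b \<in> X" "is_cone X (add_gen X I (Var a)) b"
    using assms(3) by (auto simp: dominates_def)
  note g = add_gen_Var[OF assms(1,2) ab(1)]
  have "\<forall>s\<in>face_complex X (add_gen X I (Var a)). insert b s \<in> face_complex X (add_gen X I (Var a))"
    using is_cone_iff[OF assms(2) ab(2)] ideal_mult[OF g(1)] ab(3) by blast
  then have "insert b s \<in> {s \<in> face_complex X I. a \<notin> s}"
    using assms(4,5) unfolding g(2) by blast
  then show "insert b s \<in> face_complex X I" "a \<noteq> b" by auto
qed

text \<open>Here the squares enter: if \<open>a\<close> is in \<open>s\<close>, then multiplying by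
  \<open>a\<close> produces a multiple of its square, so \<open>s\<close> is not a face of the colon
  complex.\<close>

lemma face_complex_colon:
  assumes "quadratic_monomial_ideal X I" "finite X" "a \<in> X"
  shows "face_complex X (colon X I (Var a)) = {s. a \<notin> s \<and> insert a s \<in> face_complex X I}"
proof -
  have "sqfree_monom s \<in> colon X I (Var a) \<longleftrightarrow> a \<in> s \<or> sqfree_monom (insert a s) \<in> I" if "s \<subseteq> X" for s
  proof -
    have fs: "finite s" using that assms(2) finite_subset by blast
    note c = sqfree_monom_carrier[OF fs that]
    have "Var a * sqfree_monom s \<in> I" if "a \<in> s"
    proof -
      have "Var a * sqfree_monom s = Var a ^ 2 * sqfree_monom (s - {a})"
        using sqfree_monom_remove[OF fs that] by (simp add: power2_eq_square mult.assoc)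
      moreover have "sqfree_monom (s - {a}) \<in> carrier (poly_ring X)"
        using fs \<open>s \<subseteq> X\<close> by (intro sqfree_monom_carrier) auto
      ultimately show ?thesis using assms(1,3) by (simp add: quadratic_monomial_ideal_def)
    qed
    then show ?thesis
      using c sqfree_monom_insert[OF fs, of a] by (cases "a \<in> s") (simp_all add: colon_def)
  qed
  then show ?thesis using assms(3) by (auto simp: face_complex_def)
qed

lemma dominates_collapses:
  assumes "quadratic_monomial_ideal X I" "finite X" "dominates X I a b" "Var a \<notin> I"
  shows "collapses (face_complex X I) (two_point_join a b (face_complex X (colon X I (Var a))))"
    (is "collapses ?D (two_point_join a b ?L)")
proof -
  have aX: "a \<in> X" using assms(3) by (simp add: dominates_def)
  note fD = finite_complex_face_complex[OF assms(2,1)]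
  note fL = finite_complex_face_complex[OF assms(2) quadratic_monomial_ideal_colon[OF assms(1) aX]]
  note L = face_complex_colon[OF assms(1,2) aX]
  note D = finite_complexD(3)[OF fD]
  have a: "{a} \<in> ?D" using aX assms(4) by (auto simp: face_complex_def sqfree_monom_def)
  then have e: "{} \<in> ?L" unfolding L by simp
  have ab: "a \<noteq> b" using dominatesD(2)[OF assms(1-3), of "{}"] D[OF a] by blast
  have sub: "?L \<subseteq> ?D" using D unfolding L by blast
  note dom = dominatesD(1)[OF assms(1-3)]
  show ?thesis
  proof (rule vertex_collapse[where b = b])
    show "finite_complex ?D" by (rule fD)
    show "two_point_join a b ?L \<subseteq> ?D"
      unfolding two_point_join_def using sub dom L by auto
    show "{} \<in> two_point_join a b ?L" using e by (simp add: two_point_join_def)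
    show "t \<in> two_point_join a b ?L" if "s \<in> two_point_join a b ?L" "t \<subseteq> s" for s t
      using finite_complexD(3)[OF finite_complex_two_point_join[OF fL] that] .
  next
    fix s assume s: "s \<in> ?D" "s \<notin> two_point_join a b ?L"
    \<comment> \<open>Every face through \<open>a\<close> is \<open>insert a\<close> of a face of
      the link, so only faces avoiding \<open>a\<close> are left to be matched, and domination
      allows adding \<open>b\<close> to them.\<close>
    have "a \<notin> s"
    proof
      assume "a \<in> s"
      then have "s = insert a (s - {a})" "s - {a} \<in> ?L" using s(1) unfolding L by (auto simp: insert_absorb)
      then show False using s(2) unfolding two_point_join_def by blast
    qed
    then show "insert b s \<in> ?D" using dom s(1) by blast
  next
    fix s assume s: "s \<in> two_point_join a b ?L" "insert b s \<in> ?D"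
    then consider "s \<in> ?L \<union> insert b ` ?L" | t where "t \<in> ?L" "s = insert a t"
      unfolding two_point_join_def by blast
    then show "insert b s \<in> two_point_join a b ?L"
    proof cases
      case 2
      then have "insert b t \<in> ?L" using s(2) ab unfolding L by (simp add: insert_commute)
      then show ?thesis unfolding two_point_join_def 2(2) insert_commute[of b a] by blast
    qed (auto simp: two_point_join_def)
  qed
qed

section \<open>Resolutions\<close>

lemma colon_one: "quadratic_monomial_ideal X I \<Longrightarrow> colon X I 1 = I"
  by (auto simp: colon_def quadratic_monomial_ideal_def)

lemma colon_seq_0: "quadratic_monomial_ideal X I \<Longrightarrow> colon_seq X I A 0 = I"
  by (simp add: colon_seq_def colon_one)

lemma prod_Var_carrier: "set A \<subseteq> X \<Longrightarrow> prod_list (map Var A) \<in> carrier (poly_ring X)"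
proof (induction A)
  case Nil
  then show ?case by (simp add: carrier_poly_ring)
next
  case (Cons a A)
  then show ?case by (simp add: mult_carrier_poly_ring Var_carrier)
qed

text \<open>Iterated colons compose, so an induction on the sequence can replace \<open>I\<close> by
  \<open>(I : a)\<close>. The outer colon requires its products to lie in
  \<open>poly_ring X\<close>, whence the condition on \<open>A\<close>.\<close>

lemma colon_seq_Cons:
  assumes "set A \<subseteq> X"
  shows "colon_seq X I (a # A) (Suc i) = colon_seq X (colon X I (Var a)) A i"
proof -
  have "prod_list (map Var (take i A)) \<in> carrier (poly_ring X)"
    using assms by (intro prod_Var_carrier) (meson set_take_subset subset_trans)
  then show ?thesis by (auto simp: colon_seq_def colon_def mult.assoc mult_carrier_poly_ring)
qed

lemma core_Nil: "quadratic_monomial_ideal X I \<Longrightarrow> core X I [] = I"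
  by (simp add: core_def colon_seq_0)

lemma core_Cons: "set A \<subseteq> X \<Longrightarrow> core X I (a # A) = core X (colon X I (Var a)) A"
  by (simp add: core_def colon_seq_Cons)

lemma resolution_Cons:
  assumes "quadratic_monomial_ideal X I" "resolution X I (a # A)"
  shows "a \<in> X" "set A \<subseteq> X" "Var a \<notin> I" "is_cone X I a \<or> (\<exists>b. dominates X I a b)"
    "resolution X (colon X I (Var a)) A"
proof -
  show a: "a \<in> X" and A: "set A \<subseteq> X" using assms(2) by (auto simp: resolution_def)
  have *: "Var ((a # A) ! i) \<notin> colon_seq X I (a # A) i \<and>
        (is_cone X (colon_seq X I (a # A) i) ((a # A) ! i) \<or>
         (\<exists>b\<in>X. dominates X (colon_seq X I (a # A) i) ((a # A) ! i) b))" if "i \<le> length A" for i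
    using assms(2) that unfolding resolution_def by auto
  show "Var a \<notin> I" "is_cone X I a \<or> (\<exists>b. dominates X I a b)"
    using *[of 0] by (auto simp: colon_seq_0[OF assms(1)])
  show "resolution X (colon X I (Var a)) A"
    unfolding resolution_def
  proof (intro conjI allI impI)
    fix i assume "i < length A"
    then have "Suc i \<le> length A" by simp
    note i = *[OF this, unfolded colon_seq_Cons[OF A] nth_Cons_Suc]
    show "Var (A ! i) \<notin> colon_seq X (colon X I (Var a)) A i" using i by blast
    show "is_cone X (colon_seq X (colon X I (Var a)) A i) (A ! i) \<or>
         (\<exists>b\<in>X. dominates X (colon_seq X (colon X I (Var a)) A i) (A ! i) b)" using i by blast
  qed (rule A)
qed

lemma spherical_Cons:
  assumes "quadratic_monomial_ideal X I" "set A \<subseteq> X"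
  shows "spherical X I (a # A) \<longleftrightarrow> \<not> is_cone X I a \<and> spherical X (colon X I (Var a)) A"
  using colon_seq_0[OF assms(1), of "a # A"] colon_seq_Cons[OF assms(2), of I a]
  unfolding spherical_def length_Cons All_less_Suc2 by simp

lemma conical_resolution_collapses:
  assumes "finite X" "quadratic_monomial_ideal X I" "resolution X I A" "conical X I A"
  shows "\<exists>v. collapses (face_complex X I) {{}, {v}}"
  using assms(2-)
proof (induction A arbitrary: I)
  case Nil
  then show ?case by (simp add: conical_def spherical_def)
next
  case (Cons a A)
  note r = resolution_Cons[OF Cons.prems(1,2)]
  note q = quadratic_monomial_ideal_colon[OF Cons.prems(1) r(1)]
  note fin = finite_complex_face_complex[OF assms(1) Cons.prems(1)]
  let ?L = "face_complex X (colon X I (Var a))"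
  have "{a} \<in> face_complex X I" using r(1,3) by (auto simp: face_complex_def sqfree_monom_def)
  then have e: "{} \<in> face_complex X I" using finite_complexD(3)[OF fin] by blast
  show ?case
  proof (cases "is_cone X I a")
    case True
    then have "insert a s \<in> face_complex X I" if "s \<in> face_complex X I" for s
      using is_cone_iff[OF assms(1) r(1)] that Cons.prems(1) by (auto simp: quadratic_monomial_ideal_def)
    then show ?thesis using cone_collapses[OF fin e] by blast
  next
    case False
    then have "conical X (colon X I (Var a)) A"
      using Cons.prems(3) spherical_Cons[OF Cons.prems(1) r(2)] by (simp add: conical_def)
    then obtain v where v: "collapses ?L {{}, {v}}" using Cons.IH[OF q r(5)] by blast
    obtain b where b: "dominates X I a b" using False r(4) by blast
    have ab: "a \<noteq> b" using dominatesD(2)[OF Cons.prems(1) assms(1) b e] by blast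
    have "a \<notin> \<Union>?L" using face_complex_colon[OF Cons.prems(1) assms(1) r(1)] by auto
    then have "collapses (two_point_join a b ?L) (two_point_join a b {{}, {v}})"
      using two_point_join_collapses[OF v _ ab] by blast
    \<comment> \<open>The join with a single point \<open>v\<close> is a cone with apex
      \<open>v\<close>, even if \<open>v\<close> equals \<open>b\<close>.\<close>
    moreover have "collapses (two_point_join a b {{}, {v}}) {{}, {v}}"
    proof (rule cone_collapses)
      show "finite_complex (two_point_join a b {{}, {v}})"
        by (rule finite_complex_two_point_join) (auto simp: finite_complex_def subset_singleton_iff)
    qed (auto simp: two_point_join_def)
    ultimately show ?thesis
      using dominates_collapses[OF Cons.prems(1) assms(1) b r(3)] collapses_trans by blast
  qed
qed

text \<open>The collapse of the link obtained by induction is lifted through the outermost pair.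
  Lifting only requires \<open>a\<close> to be outside the link and different from \<open>b\<close>,
  so the \<open>b\<close>s may recur among the later vertices.\<close>

lemma spherical_resolution_collapses:
  assumes "finite X" "quadratic_monomial_ideal X I" "resolution X I A" "length B = length A"
    "\<forall>i < length A. dominates X (colon_seq X I A i) (A ! i) (B ! i)"
  shows "collapses (face_complex X I)
    (complex_join [complex_join (map2 (\<lambda>a b. {{}, {a}, {b}}) A B), face_complex X (core X I A)])"
  using assms(2-)
proof (induction A arbitrary: I B)
  case Nil
  then show ?case by (simp add: complex_join_pair complex_join_Nil core_Nil collapses_def)
next
  case (Cons a A)
  then obtain b B' where B: "B = b # B'" "length B' = length A" by (cases B) auto
  note r = resolution_Cons[OF Cons.prems(1,2)]
  note q = quadratic_monomial_ideal_colon[OF Cons.prems(1) r(1)]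
  let ?L = "face_complex X (colon X I (Var a))"
  have b: "dominates X I a b"
    using Cons.prems(4) B colon_seq_0[OF Cons.prems(1)] by (metis length_greater_0_conv list.discI nth_Cons_0)
  have d: "\<forall>i < length A. dominates X (colon_seq X (colon X I (Var a)) A i) (A ! i) (B' ! i)"
    using Cons.prems(4) B colon_seq_Cons[OF r(2)] by (metis Suc_less_eq length_Cons nth_Cons_Suc)
  have "{a} \<in> face_complex X I" using r(1,3) by (auto simp: face_complex_def sqfree_monom_def)
  then have "{} \<in> face_complex X I"
    using finite_complexD(3)[OF finite_complex_face_complex[OF assms(1) Cons.prems(1)]] by blast
  then have ab: "a \<noteq> b" using dominatesD(2)[OF Cons.prems(1) assms(1) b] by blast
  have "a \<notin> \<Union>?L" using face_complex_colon[OF Cons.prems(1) assms(1) r(1)] by auto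
  then have "collapses (two_point_join a b ?L) (two_point_join a b
      (complex_join [complex_join (map2 (\<lambda>a b. {{}, {a}, {b}}) A B'), face_complex X (core X (colon X I (Var a)) A)]))"
    using two_point_join_collapses[OF Cons.IH[OF q r(5) B(2) d] _ ab] by blast
  then show ?case
    using dominates_collapses[OF Cons.prems(1) assms(1) b r(3)] collapses_trans
    unfolding B(1) core_Cons[OF r(2)] zip_Cons_Cons list.map prod.case complex_join_two_point_Cons by blast
qed

text \<open>Each pair becomes a genuine suspension before the induction hypothesis on the link is
  used, because in the full join the \<open>b\<close>s may coincide with other vertices.\<close>

lemma spherical_resolution_suspension:
  fixes X :: "'v::infinite set"
  assumes "finite X" "quadratic_monomial_ideal X I" "resolution X I A" "spherical X I A"
    "(suspension ^^ length A) (face_complex X (core X I A)) S"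
  shows "simple_homotopic (face_complex X I) S"
  using assms(2-)
proof (induction A arbitrary: I S)
  case Nil
  then show ?case by (simp add: core_Nil simple_homotopic_refl)
next
  case (Cons a A)
  note r = resolution_Cons[OF Cons.prems(1,2)]
  note q = quadratic_monomial_ideal_colon[OF Cons.prems(1) r(1)]
  let ?L = "face_complex X (colon X I (Var a))"
  note fL = finite_complex_face_complex[OF assms(1) q]
  have sp: "\<not> is_cone X I a" "spherical X (colon X I (Var a)) A"
    using Cons.prems(3) spherical_Cons[OF Cons.prems(1) r(2)] by auto
  obtain b where b: "dominates X I a b" using sp(1) r(4) by blast
  have "{a} \<in> face_complex X I" using r(1,3) by (auto simp: face_complex_def sqfree_monom_def)
  then have "{} \<in> face_complex X I"
    using finite_complexD(3)[OF finite_complex_face_complex[OF assms(1) Cons.prems(1)]] by blast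
  then have ab: "a \<noteq> b" using dominatesD(2)[OF Cons.prems(1) assms(1) b] by blast
  have aL: "a \<notin> \<Union>?L" using face_complex_colon[OF Cons.prems(1) assms(1) r(1)] by auto
  \<comment> \<open>The relational power applies its last factor outermost: \<open>T\<close> is the
    suspension belonging to the link, and \<open>S\<close> suspends it once more.\<close>
  obtain T where T: "(suspension ^^ length A) (face_complex X (core X (colon X I (Var a)) A)) T" "suspension T S"
    using Cons.prems(4) unfolding core_Cons[OF r(2)] by auto
  have LT: "simple_homotopic ?L T" using Cons.IH[OF q r(5) sp(2) T(1)] .
  have "finite (\<Union>?L \<union> {a, b})" using finite_complexD(4)[OF fL] by simp
  then obtain c where c: "c \<notin> \<Union>?L \<union> {a, b}" using ex_new_if_finite[OF infinite_UNIV] by blast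
  have "simple_homotopic (face_complex X I) (two_point_join a b ?L)"
    using dominates_collapses[OF Cons.prems(1) assms(1) b r(3)] by (rule collapses_imp_simple_homotopic)
  moreover have "simple_homotopic (two_point_join a b ?L) (two_point_join a c ?L)"
    by (rule two_point_join_replace[OF fL aL ab]) (use c in auto)
  moreover have "suspension ?L (two_point_join a c ?L)" by (rule suspensionI) (use aL c in auto)
  \<comment> \<open>The vertices that lead from \<open>T\<close> to \<open>S\<close> are unrelated
    to \<open>a\<close> and \<open>c\<close>; invariance of suspension under simple-homotopy bridges
    the difference.\<close>
  then have "simple_homotopic (two_point_join a c ?L) S"
    using suspension_simple_homotopic[OF LT fL _ T(2)] by blast
  ultimately show ?case using simple_homotopic_trans by blast
qed

theorem theorem4p3:
  fixes X :: "'v::infinite set" and I :: "'v zpoly set" and A :: "'v list"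
  assumes "finite X"
    and "monomial_ideal X I"
    and "\<forall>x\<in>X. Var x ^ 2 \<in> I"
    and "resolution X I A"
  shows "(conical X I A \<longrightarrow> (\<exists>v. collapses (face_complex X I) {{}, {v}})) \<and>
    (spherical X I A \<longrightarrow>
      (\<forall>B. length B = length A \<and>
           (\<forall>i < length A. dominates X (colon_seq X I A i) (A ! i) (B ! i)) \<longrightarrow>
         collapses (face_complex X I)
           (complex_join [complex_join (map2 (\<lambda>a b. {{}, {a}, {b}}) A B), face_complex X (core X I A)])) \<and>
      (\<forall>S. (suspension ^^ depth A) (face_complex X (core X I A)) S \<longrightarrow> simple_homotopic (face_complex X I) S))"
proof -
  have q: "quadratic_monomial_ideal X I" using assms(2,3) by (rule monomial_ideal_imp_quadratic)
  show ?thesis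
    using conical_resolution_collapses[OF assms(1) q assms(4)]
      spherical_resolution_collapses[OF assms(1) q assms(4)]
      spherical_resolution_suspension[OF assms(1) q assms(4)]
    unfolding depth_def by blast
qed

end
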